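(* Let $(X,A,m,\alpha,r)$ be a reversible micro-macro system. (a) For non-empty subsets $a,b\subseteq X$, $|[\![a,b]\!]|=|[\![rb,ra]\!]|$, and hence $[\alpha]_{ab}=e^{S(b)-S(a)}[\alpha]_{rb,ra}$. (b) $(p,[\alpha^{-1}])$ is the reversed Markov chain of $(p,[\alpha])$, i.e. $[\alpha^{-1}]_{ab}=\frac{p_b}{p_a}[\alpha]_{ba}$ for $a,b\in A$. (c) The Markov chain $(p,[\alpha])$ is reversible if and only if $|[\![a,b]\!]|=|[\![b,a]\!]|$ for all $a,b\in A$. (d) If $r$ is invariant, then $(p,[\alpha])$ is reversible.
   Context: A micro-macro system $(X,A,m,\alpha)$ consists of finite sets $X$, $A$, a bijection $\alpha:X\to X$ and a surjection $m:X\to A$; identify $a\in A$ with $m^{-1}(a)$. It is reversible with reversion $r:X\to X$ if $r^2=\mathrm{id}$ and $\alpha^{-1}=r\alpha r$; $r$ is invariant if $mr=m$. For subsets $a,b\subseteq X$: $[\![a,b]\!]=\{i\in a:\alpha(i)\in b\}$, $[\alpha]_{ab}=|[\![a,b]\!]|/|a|$, $S(a)=\ln|a|$, $ra=r(a)$. $p_a=|a|/|X|$. $(p,[\alpha])$ denotes the Markov chain on $A$ with initial law $p$ and transition matrix $([\alpha]_{ab})_{a,b\in A}$; $[\alpha^{-1}]$ is defined likewise with $\alpha^{-1}$. The chain is reversible if $p_a[\alpha]_{ab}=p_b[\alpha]_{ba}$ for all $a,b$. *)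

theory Defs
  imports Complex_Main "HOL-Library.FuncSet"
begin

text \<open>
  The sets \<open>X\<close> and \<open>A\<close> are carriers inside arbitrary types. All maps are only
  constrained on the carriers, and the inverse of \<open>\<alpha>\<close> is \<open>inv_into X \<alpha>\<close>.
\<close>

locale micro_macro_system =
  fixes X :: "'x set" and A :: "'a set" and m :: "'x \<Rightarrow> 'a" and \<alpha> :: "'x \<Rightarrow> 'x"
  assumes finite_X: "finite X"
    and finite_A: "finite A"
    and bij_\<alpha>: "bij_betw \<alpha> X X"
    and surj_m: "m ` X = A"

locale reversible_micro_macro_system = micro_macro_system X A m \<alpha>
  for X :: "'x set" and A :: "'a set" and m :: "'x \<Rightarrow> 'a" and \<alpha> :: "'x \<Rightarrow> 'x" +
  fixes r :: "'x \<Rightarrow> 'x"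
  assumes r_closed: "r \<in> X \<rightarrow> X"
    and r_involution: "\<forall>x\<in>X. r (r x) = x"
    and r_reverses: "\<forall>x\<in>X. inv_into X \<alpha> x = r (\<alpha> (r x))"

definition invariant_reversion :: "'x set \<Rightarrow> ('x \<Rightarrow> 'a) \<Rightarrow> ('x \<Rightarrow> 'x) \<Rightarrow> bool" where
  "invariant_reversion X m r \<longleftrightarrow> (\<forall>x\<in>X. m (r x) = m x)"

definition macrostate :: "'x set \<Rightarrow> ('x \<Rightarrow> 'a) \<Rightarrow> 'a \<Rightarrow> 'x set" where
  "macrostate X m a = {x \<in> X. m x = a}"

definition transitions :: "('x \<Rightarrow> 'x) \<Rightarrow> 'x set \<Rightarrow> 'x set \<Rightarrow> 'x set" where
  "transitions f a b = {i \<in> a. f i \<in> b}"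

definition trans_prob :: "('x \<Rightarrow> 'x) \<Rightarrow> 'x set \<Rightarrow> 'x set \<Rightarrow> real" where
  "trans_prob f a b = real (card (transitions f a b)) / real (card a)"

definition entropy :: "'x set \<Rightarrow> real" where
  "entropy a = ln (real (card a))"

definition macro_law :: "'x set \<Rightarrow> ('x \<Rightarrow> 'a) \<Rightarrow> 'a \<Rightarrow> real" where
  "macro_law X m a = real (card (macrostate X m a)) / real (card X)"

definition macro_matrix :: "'x set \<Rightarrow> ('x \<Rightarrow> 'a) \<Rightarrow> ('x \<Rightarrow> 'x) \<Rightarrow> 'a \<Rightarrow> 'a \<Rightarrow> real" where
  "macro_matrix X m f a b = trans_prob f (macrostate X m a) (macrostate X m b)"

text \<open>
  A Markov chain on \<open>A\<close> is given by its initial law \<open>p\<close> and its transition matrix \<open>P\<close>.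
\<close>

definition markov_chain :: "'a set \<Rightarrow> ('a \<Rightarrow> real) \<Rightarrow> ('a \<Rightarrow> 'a \<Rightarrow> real) \<Rightarrow> bool" where
  "markov_chain A p P \<longleftrightarrow>
     (\<forall>a\<in>A. 0 \<le> p a) \<and> (\<Sum>a\<in>A. p a) = 1 \<and>
     (\<forall>a\<in>A. (\<forall>b\<in>A. 0 \<le> P a b) \<and> (\<Sum>b\<in>A. P a b) = 1)"

definition reversed_markov_chain ::
    "'a set \<Rightarrow> ('a \<Rightarrow> real) \<Rightarrow> ('a \<Rightarrow> 'a \<Rightarrow> real) \<Rightarrow> ('a \<Rightarrow> 'a \<Rightarrow> real) \<Rightarrow> bool" where
  "reversed_markov_chain A p P Q \<longleftrightarrow> (\<forall>a\<in>A. \<forall>b\<in>A. Q a b = p b / p a * P b a)"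

definition reversible_markov_chain ::
    "'a set \<Rightarrow> ('a \<Rightarrow> real) \<Rightarrow> ('a \<Rightarrow> 'a \<Rightarrow> real) \<Rightarrow> bool" where
  "reversible_markov_chain A p P \<longleftrightarrow> (\<forall>a\<in>A. \<forall>b\<in>A. p a * P a b = p b * P b a)"

lemma (in micro_macro_system) sum_card_macrostate:
  assumes "Y \<subseteq> X"
  shows "(\<Sum>b\<in>A. card {i \<in> Y. m i = b}) = card Y"
proof -
  have Y: "finite Y" using assms finite_X finite_subset by blast
  have "card (\<Union>b\<in>A. {i \<in> Y. m i = b}) = (\<Sum>b\<in>A. card {i \<in> Y. m i = b})"
    by (rule card_UN_disjoint) (use finite_A Y in auto)
  moreover have "(\<Union>b\<in>A. {i \<in> Y. m i = b}) = Y"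
    using assms surj_m by auto
  ultimately show ?thesis by simp
qed

text \<open>
  Outside the degenerate case \<open>X = {}\<close>, where also \<open>A = {}\<close> and there is no law on \<open>A\<close>,
  the pair of \<open>macro_law\<close> and \<open>macro_matrix\<close> is a Markov chain, with positive law, for
  every self-map of \<open>X\<close>. In particular this covers \<open>\<alpha>\<close> and its inverse.
\<close>

lemma (in micro_macro_system) macro_law_pos:
  assumes "a \<in> A"
  shows "0 < macro_law X m a"
proof -
  have "macrostate X m a \<noteq> {}" "X \<noteq> {}"
    using assms surj_m by (auto simp: macrostate_def)
  moreover have "finite (macrostate X m a)"
    using finite_X by (simp add: macrostate_def)
  ultimately show ?thesis
    using finite_X by (simp add: macro_law_def card_gt_0_iff)
qed

lemma (in micro_macro_system) markov_chain_macro: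
  assumes "X \<noteq> {}" and f: "f \<in> X \<rightarrow> X"
  shows "markov_chain A (macro_law X m) (macro_matrix X m f)"
proof -
  have cX: "card X \<noteq> 0" using assms finite_X by simp
  have "(\<Sum>a\<in>A. macro_law X m a) = real (\<Sum>a\<in>A. card {i \<in> X. m i = a}) / real (card X)"
    by (simp add: macro_law_def macrostate_def sum_divide_distrib)
  then have law: "(\<Sum>a\<in>A. macro_law X m a) = 1"
    using cX by (simp only: sum_card_macrostate[OF subset_refl]) simp
  have row: "(\<Sum>b\<in>A. macro_matrix X m f a b) = 1" if "a \<in> A" for a
  proof -
    let ?a = "macrostate X m a"
    have ne: "card ?a \<noteq> 0"
      using macro_law_pos[OF that] unfolding macro_law_def by (metis div_0 less_irrefl of_nat_0)
    have "card (\<Union>b\<in>A. transitions f ?a (macrostate X m b)) =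
        (\<Sum>b\<in>A. card (transitions f ?a (macrostate X m b)))"
      by (rule card_UN_disjoint)
        (use finite_A finite_X in \<open>auto simp: transitions_def macrostate_def\<close>)
    moreover have "(\<Union>b\<in>A. transitions f ?a (macrostate X m b)) = ?a"
      using f surj_m by (auto simp: transitions_def macrostate_def)
    ultimately have "real (\<Sum>b\<in>A. card (transitions f ?a (macrostate X m b))) = real (card ?a)"
      by simp
    then show ?thesis
      using ne by (simp add: macro_matrix_def trans_prob_def flip: sum_divide_distrib)
  qed
  show ?thesis
    using law row macro_law_pos
    by (auto simp: markov_chain_def macro_matrix_def trans_prob_def less_imp_le)
qed

end

theory Submission
  imports Defs
begin

text \<open>
  The map \<open>r \<circ> \<alpha>\<close> is an involution of \<open>X\<close> which exchanges the transitions from \<open>a\<close> to \<open>b\<close>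
  with those from \<open>r b\<close> to \<open>r a\<close>. Since \<open>p\<^sub>a [\<alpha>]\<^sub>a\<^sub>b\<close> is the number of transitions from \<open>a\<close>
  to \<open>b\<close> divided by the cardinality of \<open>X\<close>, every claim about the Markov chain is a claim about
  numbers of transitions.
\<close>

context micro_macro_system
begin

lemma card_macrostate_pos:
  assumes "a \<in> A"
  shows "0 < card (macrostate X m a)"
  using macro_law_pos[OF assms] by (auto simp: macro_law_def intro: gr0I)

text \<open>\<open>\<alpha>\<close> itself is the bijection: a point i of b with
  \<open>\<alpha> i\<close> in a goes to a point of a that the inverse of \<open>\<alpha>\<close>
  sends back to i in b.\<close>

lemma card_transitions_inv:
  assumes "a \<subseteq> X" "b \<subseteq> X"
  shows "card (transitions (inv_into X \<alpha>) a b) = card (transitions \<alpha> b a)"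
proof -
  have "bij_betw \<alpha> (transitions \<alpha> b a) (transitions (inv_into X \<alpha>) a b)"
    by (rule bij_betw_byWitness[where f' = "inv_into X \<alpha>"])
      (use assms bij_\<alpha> in \<open>auto simp: transitions_def bij_betw_inv_into_left
         bij_betw_inv_into_right subset_iff\<close>)
  then show ?thesis by (simp add: bij_betw_same_card)
qed

text \<open>The cardinality of the macrostate cancels, being nonzero for a in \<open>A\<close>. The
  map \<open>f\<close> is left general so that both \<open>\<alpha>\<close> and its inverse are
  covered.\<close>

lemma macro_law_times_macro_matrix:
  assumes "a \<in> A"
  shows "macro_law X m a * macro_matrix X m f a b =
    real (card (transitions f (macrostate X m a) (macrostate X m b))) / real (card X)"
  using card_macrostate_pos[OF assms]
  by (simp add: macro_law_def macro_matrix_def trans_prob_def)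

lemma reversed_markov_chain_macro:
  "reversed_markov_chain A (macro_law X m) (macro_matrix X m \<alpha>) (macro_matrix X m (inv_into X \<alpha>))"
  unfolding reversed_markov_chain_def
proof (intro ballI)
  fix a b assume ab: "a \<in> A" "b \<in> A"
  have "macro_law X m a * macro_matrix X m (inv_into X \<alpha>) a b =
      macro_law X m b * macro_matrix X m \<alpha> b a"
    using ab by (simp add: macro_law_times_macro_matrix card_transitions_inv macrostate_def)
  then show "macro_matrix X m (inv_into X \<alpha>) a b =
      macro_law X m b / macro_law X m a * macro_matrix X m \<alpha> b a"
    using macro_law_pos[OF ab(1)] by (simp add: field_simps)
qed

lemma reversible_markov_chain_macro_iff:
  "reversible_markov_chain A (macro_law X m) (macro_matrix X m f) \<longleftrightarrow>
    (\<forall>a\<in>A. \<forall>b\<in>A. card (transitions f (macrostate X m a) (macrostate X m b)) =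
                 card (transitions f (macrostate X m b) (macrostate X m a)))"
\<comment> \<open>The factor 1 / \<open>card X\<close> can be cancelled only when \<open>X\<close>
  is nonempty; otherwise \<open>A\<close> is empty and both sides hold vacuously.\<close>
proof (cases "X = {}")
  case True
  then have "A = {}" using surj_m by simp
  then show ?thesis by (simp add: reversible_markov_chain_def)
next
  case False
  then have "card X \<noteq> 0" using finite_X by simp
  then show ?thesis
    by (simp add: reversible_markov_chain_def macro_law_times_macro_matrix)
qed

end

context reversible_micro_macro_system
begin

lemma inj_on_r: "inj_on r X"
  using r_involution by (metis inj_onI)

text \<open>On \<open>X\<close> the map r \<alpha> r is the inverse of \<alpha>, so composing it
  with \<alpha> gives the identity.\<close>

lemma r_alpha_involution:
  assumes "x \<in> X"
  shows "r (\<alpha> (r (\<alpha> x))) = x"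
  using assms bij_\<alpha> r_reverses by (metis bij_betwE bij_betw_inv_into_left)

lemma alpha_r_alpha:
  assumes "x \<in> X"
  shows "\<alpha> (r (\<alpha> x)) = r x"
proof -
  have "\<alpha> (r (\<alpha> x)) \<in> X"
    using assms bij_\<alpha> r_closed by (meson PiE bij_betwE)
  then show ?thesis
    using r_alpha_involution[OF assms] r_involution by metis
qed

lemma card_transitions_reversion:
  assumes "a \<subseteq> X" "b \<subseteq> X"
  shows "card (transitions \<alpha> a b) = card (transitions \<alpha> (r ` b) (r ` a))"
proof -
  have rX: "r x \<in> X" if "x \<in> X" for x
    using that r_closed by auto
  have "bij_betw (r \<circ> \<alpha>) (transitions \<alpha> a b) (transitions \<alpha> (r ` b) (r ` a))"
  \<comment> \<open>As an involution, \<open>r \<circ> \<alpha>\<close> serves as its own inverse. A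
    point i of a with \<open>\<alpha> i\<close> in b goes to \<open>r (\<alpha> i)\<close> in
    \<open>r\<close> b\<open>, which\<close>\<alpha>\<open>sends to\<close>r i\<open>in\<close>r
    \<open>a\<close>.\<close>
  proof (rule bij_betw_byWitness[where f' = "r \<circ> \<alpha>"])
    show "\<forall>i\<in>transitions \<alpha> a b. (r \<circ> \<alpha>) ((r \<circ> \<alpha>) i) = i"
      using assms by (auto simp: transitions_def r_alpha_involution subset_iff)
    show "\<forall>j\<in>transitions \<alpha> (r ` b) (r ` a). (r \<circ> \<alpha>) ((r \<circ> \<alpha>) j) = j"
    proof
      fix j assume "j \<in> transitions \<alpha> (r ` b) (r ` a)"
      then have "j \<in> X" using assms rX by (auto simp: transitions_def)
      then show "(r \<circ> \<alpha>) ((r \<circ> \<alpha>) j) = j" by (simp add: r_alpha_involution)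
    qed
    show "(r \<circ> \<alpha>) ` transitions \<alpha> a b \<subseteq> transitions \<alpha> (r ` b) (r ` a)"
      using assms by (auto simp: transitions_def alpha_r_alpha subset_iff)
    show "(r \<circ> \<alpha>) ` transitions \<alpha> (r ` b) (r ` a) \<subseteq> transitions \<alpha> a b"
    proof clarify
      fix j assume "j \<in> transitions \<alpha> (r ` b) (r ` a)"
      then obtain x y where xy: "x \<in> b" "j = r x" "y \<in> a" "\<alpha> j = r y"
        by (auto simp: transitions_def)
      then have "x \<in> X" "y \<in> X" using assms by auto
      \<comment> \<open>Here \<open>\<alpha> (r (\<alpha> j)) = r j\<close>, and \<open>r\<close>
        undoes itself on \<open>x\<close> and \<open>y\<close>.\<close>
      then have "r (\<alpha> j) = y" "\<alpha> (r (\<alpha> j)) = x"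
        using xy rX r_involution alpha_r_alpha[of j] by auto
      then show "(r \<circ> \<alpha>) j \<in> transitions \<alpha> a b"
        using xy by (auto simp: transitions_def)
    qed
  qed
  then show ?thesis by (rule bij_betw_same_card)
qed

text \<open>The exponential is the ratio |b| / |a|. Since \<open>r\<close> is injective on
  \<open>X\<close>, |b| is also the denominator of the reversed probability and cancels.\<close>

lemma trans_prob_reversion:
  assumes "a \<subseteq> X" "a \<noteq> {}" "b \<subseteq> X" "b \<noteq> {}"
  shows "trans_prob \<alpha> a b = exp (entropy b - entropy a) * trans_prob \<alpha> (r ` b) (r ` a)"
proof -
  have pos: "0 < card a" "0 < card b"
    using assms finite_X by (auto simp: card_gt_0_iff intro: finite_subset)
  moreover have "card (r ` b) = card b"
    using assms inj_on_r by (meson card_image inj_on_subset)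
  ultimately show ?thesis
    using card_transitions_reversion[OF assms(1,3)]
    by (simp add: trans_prob_def entropy_def exp_diff)
qed

lemma image_macrostate_invariant:
  assumes "invariant_reversion X m r"
  shows "r ` macrostate X m a = macrostate X m a"
proof
  show sub: "r ` macrostate X m a \<subseteq> macrostate X m a"
    using assms r_closed by (auto simp: invariant_reversion_def macrostate_def)
  \<comment> \<open>Each x is the image of \<open>r x\<close>, which lies in the macrostate by
    \<open>sub\<close>.\<close>
  show "macrostate X m a \<subseteq> r ` macrostate X m a"
    using sub r_involution by (force simp: macrostate_def image_iff)
qed

text \<open>Every macrostate is now its own image under \<open>r\<close>, so the exchange of
  transitions by reversion becomes the symmetry of the transition counts.\<close>

lemma reversible_markov_chain_macro_invariant:
  assumes "invariant_reversion X m r"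
  shows "reversible_markov_chain A (macro_law X m) (macro_matrix X m \<alpha>)"
proof -
  have "macrostate X m a \<subseteq> X" for a
    by (auto simp: macrostate_def)
  then show ?thesis
    unfolding reversible_markov_chain_macro_iff
    using card_transitions_reversion image_macrostate_invariant[OF assms] by metis
qed

end

theorem theorem19:
  fixes X :: "'x set" and A :: "'a set" and m :: "'x \<Rightarrow> 'a" and \<alpha> r :: "'x \<Rightarrow> 'x"
  assumes "reversible_micro_macro_system X A m \<alpha> r"
  shows "(\<forall>a b. a \<subseteq> X \<and> a \<noteq> {} \<and> b \<subseteq> X \<and> b \<noteq> {} \<longrightarrow>
             card (transitions \<alpha> a b) = card (transitions \<alpha> (r ` b) (r ` a)) \<and>
             trans_prob \<alpha> a b = exp (entropy b - entropy a) * trans_prob \<alpha> (r ` b) (r ` a))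
       \<and> reversed_markov_chain A (macro_law X m) (macro_matrix X m \<alpha>)
             (macro_matrix X m (inv_into X \<alpha>))
       \<and> (reversible_markov_chain A (macro_law X m) (macro_matrix X m \<alpha>) \<longleftrightarrow>
             (\<forall>a\<in>A. \<forall>b\<in>A.
                card (transitions \<alpha> (macrostate X m a) (macrostate X m b)) =
                card (transitions \<alpha> (macrostate X m b) (macrostate X m a))))
       \<and> (invariant_reversion X m r \<longrightarrow>
             reversible_markov_chain A (macro_law X m) (macro_matrix X m \<alpha>))"
proof -
  interpret reversible_micro_macro_system X A m \<alpha> r by fact
  show ?thesis
    using card_transitions_reversion trans_prob_reversion reversed_markov_chain_macro
      reversible_markov_chain_macro_iff reversible_markov_chain_macro_invariant
    by blast
qed

end
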